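(* Let $j$ be a non-negative integer, $n$ a non-negative integer and $r\ge 2$ an integer. Then the number of partitions of $n$ with exactly $j$ multiples of $r$ (parts divisible by $r$, counted with multiplicity) equals the number of partitions of $n$ whose largest $r$-repeating part is $j$, which also equals the number of partitions of $n$ with exactly $j$ parts greater than the $(r-1)$-chain mex.
   Context: A partition of $n$ is a non-increasing sequence of positive integers summing to $n$; parts are counted with multiplicity. For a positive integer $r$, an $r$-repeating part of a partition is an integer occurring at least $r$ times; the largest $r$-repeating part is the largest such integer, taken to be $0$ if none exists. For a positive integer $s$, the $s$-chain mex of a partition is the least positive integer $k$ such that none of $k,k+1,\dots,k+s-1$ occurs as a part (so the $1$-chain mex is the usual mex). *)

theory Defs
  imports Main
begin

definition is_partition :: "nat \<Rightarrow> nat list \<Rightarrow> bool" where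
  "is_partition n p \<longleftrightarrow> sorted_wrt (\<ge>) p \<and> (\<forall>x\<in>set p. 0 < x) \<and> sum_list p = n"

definition repeating_part :: "nat \<Rightarrow> nat list \<Rightarrow> nat \<Rightarrow> bool" where
  "repeating_part r p k \<longleftrightarrow> r \<le> count_list p k"

text \<open>
  For \<open>0 < r\<close> the set below is finite, so \<open>Max\<close> is a genuine maximum; inserting \<open>0\<close>
  gives the value \<open>0\<close> when there is no \<open>r\<close>-repeating part, and changes nothing
  otherwise because parts are positive.
\<close>
definition largest_repeating_part :: "nat \<Rightarrow> nat list \<Rightarrow> nat" where
  "largest_repeating_part r p = Max (insert 0 {k. repeating_part r p k})"

definition chain_mex :: "nat \<Rightarrow> nat list \<Rightarrow> nat" where
  "chain_mex s p = (LEAST k. 0 < k \<and> (\<forall>i<s. k + i \<notin> set p))"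

end

theory Submission imports Defs "HOL-Library.Multiset" begin

text \<open>
  Write each multiplicity as \<open>r a + b\<close> with \<open>b < r\<close>: this splits a partition into one without
  \<open>r\<close>-repeating parts and \<open>r\<close> copies of a second one, whose largest part is the largest
  \<open>r\<close>-repeating part. Splitting off the multiples of \<open>r\<close> instead leaves a partition without
  multiples of \<open>r\<close> and \<open>r\<close> times a second one, whose number of parts is the number of multiples
  of \<open>r\<close>. The first components are equinumerous by Glaisher's theorem, which follows from the same
  two splittings by cancelling the partition numbers from two convolutions, and the second
  components are exchanged by conjugation. Conjugation also turns the first \<open>r - 1\<close> consecutive
  missing parts into the largest part repeated \<open>r\<close> times, which gives the second equality.
\<close>

section \<open>Conjugation\<close>

text \<open>In the Young diagram with rows \<open>p\<close>, this is the length of column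
  \<open>i\<close>, with columns numbered from 0.\<close>

abbreviation parts_above :: "nat list \<Rightarrow> nat \<Rightarrow> nat" where
  "parts_above p i \<equiv> length (filter (\<lambda>x. i < x) p)"

definition largest_part :: "nat list \<Rightarrow> nat" where
  "largest_part p = Max (insert 0 (set p))"

definition conjugate :: "nat list \<Rightarrow> nat list" where
  "conjugate p = map (parts_above p) [0..<largest_part p]"

text \<open>Both sides say that the diagram has a cell in row \<open>k\<close> and column
  \<open>i\<close>: in a non-increasing list the entries above \<open>i\<close> form an initial
  segment.\<close>

lemma less_parts_above_iff:
  assumes "sorted_wrt (\<ge>) p"
  shows "k < parts_above p i \<longleftrightarrow> k < length p \<and> i < p ! k"
  using assms
proof (induction p arbitrary: k)
  case (Cons a p)
  show ?case
  proof (cases "i < a")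
    case True
    with Cons show ?thesis by (cases k) auto
  next
    case False
    then have small: "\<forall>x\<in>set (a # p). x \<le> i"
      using Cons.prems by auto
    then have "filter (\<lambda>x. i < x) (a # p) = []"
      by (force simp: filter_empty_conv)
    moreover have "k < length (a # p) \<Longrightarrow> (a # p) ! k \<le> i"
      using small nth_mem by blast
    ultimately show ?thesis by (metis length_0_conv not_less not_less_zero)
  qed
qed simp

lemma parts_above_antimono: "i \<le> k \<Longrightarrow> parts_above p k \<le> parts_above p i"
  by (induction p) auto

lemma parts_above_Suc: "parts_above p i = parts_above p (Suc i) + count_list p (Suc i)"
  by (induction p) auto

lemma le_largest_part: "x \<in> set p \<Longrightarrow> x \<le> largest_part p"
  by (simp add: largest_part_def)

lemma less_largest_part_iff: "i < largest_part p \<longleftrightarrow> 0 < parts_above p i"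
  by (auto simp: largest_part_def Max_gr_iff filter_empty_conv)

text \<open>Double counting of cells, by columns and by rows: a part \<open>a\<close> puts one cell
  into each of the columns \<open>0, ..., a - 1\<close>.\<close>

lemma sum_parts_above:
  assumes "\<forall>x\<in>set p. x \<le> m"
  shows "(\<Sum>i<m. parts_above p i) = sum_list p"
  using assms
proof (induction p)
  case (Cons a p)
  have "(\<Sum>i<m. parts_above (a # p) i) = (\<Sum>i<m. (if i < a then 1 else 0) + parts_above p i)"
    by (rule sum.cong) auto
  also have "\<dots> = (\<Sum>i<m. if i < a then 1 else 0) + sum_list p"
    using Cons by (simp add: sum.distrib)
  also have "(\<Sum>i<m. if i < a then 1 else (0::nat)) = card {i \<in> {..<m}. i < a}"
    by (simp add: sum.If_cases Int_def)
  also have "{i \<in> {..<m}. i < a} = {..<a}"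
    using Cons.prems by auto
  finally show ?case by simp
qed simp

lemma length_filter_conjugate:
  "length (filter P (conjugate p)) = card {i. i < largest_part p \<and> P (parts_above p i)}"
proof -
  have "length (filter P (conjugate p)) = length (filter (P \<circ> parts_above p) [0..<largest_part p])"
    by (simp add: conjugate_def filter_map)
  also have "\<dots> = card (set (filter (P \<circ> parts_above p) [0..<largest_part p]))"
    by (rule distinct_card[symmetric]) simp
  also have "set (filter (P \<circ> parts_above p) [0..<largest_part p]) =
      {i. i < largest_part p \<and> P (parts_above p i)}"
    by auto
  finally show ?thesis .
qed

lemma count_list_conjugate:
  assumes "0 < k"
  shows "count_list (conjugate p) k = card {i. parts_above p i = k}"
proof -
  have "count_list (conjugate p) k = length (filter ((=) k) (conjugate p))"
    by (simp add: count_list_eq_length_filter)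
  also have "\<dots> = card {i. parts_above p i = k}"
    using assms
    by (auto simp: length_filter_conjugate less_largest_part_iff intro!: arg_cong[where f = card])
  finally show ?thesis .
qed

text \<open>Column \<open>k\<close> of the transposed diagram is row \<open>k\<close> of the
  original one; this is what makes conjugation an involution.\<close>

lemma parts_above_conjugate:
  assumes "is_partition n p" "k < length p"
  shows "parts_above (conjugate p) k = p ! k"
proof -
  have "parts_above (conjugate p) k = card {i. i < largest_part p \<and> k < parts_above p i}"
    by (rule length_filter_conjugate)
  also have "{i. i < largest_part p \<and> k < parts_above p i} = {..<p ! k}"
    using assms less_parts_above_iff[of p k] le_largest_part[of "p ! k" p]
    by (auto simp: is_partition_def)
  finally show ?thesis by simp
qed

lemma largest_part_conjugate:
  assumes "is_partition n p"
  shows "largest_part (conjugate p) = length p"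
proof -
  \<comment> \<open>Two natural numbers with the same strict lower bounds are equal.\<close>
  have "i < largest_part (conjugate p) \<longleftrightarrow> i < length p" for i
  proof -
    have "i < largest_part (conjugate p) \<longleftrightarrow> (\<exists>x\<in>set (conjugate p). i < x)"
      by (auto simp: largest_part_def Max_gr_iff)
    also have "\<dots> \<longleftrightarrow> (\<exists>l<largest_part p. i < parts_above p l)"
      by (auto simp: conjugate_def)
    \<comment> \<open>Column 0 is the longest one, and it meets every row because all parts are
      positive.\<close>
    also have "\<dots> \<longleftrightarrow> i < parts_above p 0"
      by (metis less_largest_part_iff parts_above_antimono gr_zeroI le0 not_less0 order_less_le_trans)
    also have "parts_above p 0 = length p"
      using assms by (simp add: is_partition_def)
    finally show ?thesis .
  qed
  then show ?thesis by (metis linorder_neqE_nat less_irrefl)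
qed

lemma is_partition_conjugate:
  assumes "is_partition n p"
  shows "is_partition n (conjugate p)"
proof -
  have "sorted_wrt (\<ge>) (conjugate p)"
    by (simp add: conjugate_def sorted_wrt_iff_nth_less parts_above_antimono)
  moreover have "\<forall>x\<in>set (conjugate p). 0 < x"
    by (simp add: conjugate_def less_largest_part_iff)
  moreover have "sum_list (conjugate p) = n"
    using assms sum_parts_above[of p "largest_part p"]
    by (simp add: conjugate_def is_partition_def le_largest_part interv_sum_list_conv_sum_set_nat
        atLeast0LessThan)
  ultimately show ?thesis by (simp add: is_partition_def)
qed

lemma conjugate_conjugate:
  assumes "is_partition n p"
  shows "conjugate (conjugate p) = p"
proof -
  have "conjugate (conjugate p) = map (parts_above (conjugate p)) [0..<length p]"
    using largest_part_conjugate[OF assms] by (simp add: conjugate_def[of "conjugate p"])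
  also have "\<dots> = p"
    by (rule nth_equalityI) (simp_all add: parts_above_conjugate[OF assms])
  finally show ?thesis .
qed

text \<open>One hypothesis covers both directions, because conjugation is its own inverse on the
  partitions of \<open>n\<close>.\<close>

lemma card_conjugate:
  assumes "\<And>p. is_partition n p \<Longrightarrow> P p \<longleftrightarrow> Q (conjugate p)"
  shows "card {p. is_partition n p \<and> P p} = card {p. is_partition n p \<and> Q p}"
  by (rule bij_betw_same_card[of conjugate], rule bij_betw_byWitness[where f' = conjugate])
    (auto simp: assms is_partition_conjugate conjugate_conjugate)

section \<open>The chain mex and the largest repeating part\<close>

text \<open>The multiplicity of \<open>k\<close> in the conjugate is the size of a level set of the
  antitone function \<open>parts_above p\<close>. Such a level set is an interval, so having at
  least \<open>r\<close> elements means containing \<open>r\<close> consecutive columns.\<close>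

lemma repeating_part_conjugate_iff:
  assumes "0 < k" "0 < r"
  shows "repeating_part r (conjugate p) k \<longleftrightarrow> (\<exists>a. \<forall>i<r. parts_above p (a + i) = k)"
proof
  let ?S = "{i. parts_above p i = k}"
  \<comment> \<open>Positivity of \<open>k\<close> matters here: the level set at height 0 is
    infinite.\<close>
  have fin: "finite ?S"
    by (rule finite_subset[of _ "{..<largest_part p}"]) (use assms in \<open>auto simp: less_largest_part_iff\<close>)
  {
    assume "repeating_part r (conjugate p) k"
    then have card: "r \<le> card ?S"
      using assms by (simp add: repeating_part_def count_list_conjugate)
    then have ne: "?S \<noteq> {}"
      using assms by (metis card.empty not_less)
    \<comment> \<open>At least \<open>r\<close> elements force \<open>Max ?S\<close> to be at least
      \<open>Min ?S + r - 1\<close>; monotonicity then pins all values in between to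
      \<open>k\<close>.\<close>
    have "card ?S \<le> card {Min ?S..Max ?S}"
      by (rule card_mono) (use fin in auto)
    then have le: "Min ?S + i \<le> Max ?S" if "i < r" for i
      using card that by simp
    have "parts_above p (Min ?S) = k" "parts_above p (Max ?S) = k"
      using Min_in[OF fin ne] Max_in[OF fin ne] by auto
    then have "parts_above p (Min ?S + i) = k" if "i < r" for i
      using parts_above_antimono[OF le[OF that], of p]
        parts_above_antimono[of "Min ?S" "Min ?S + i" p] by simp
    then show "\<exists>a. \<forall>i<r. parts_above p (a + i) = k" by blast
  }
  {
    assume "\<exists>a. \<forall>i<r. parts_above p (a + i) = k"
    then obtain a where a: "\<forall>i<r. parts_above p (a + i) = k" by blast
    have "(+) a ` {..<r} \<subseteq> ?S"
      using a by auto
    then have "card ((+) a ` {..<r}) \<le> card ?S"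
      by (rule card_mono[OF fin])
    then show "repeating_part r (conjugate p) k"
      using assms by (simp add: repeating_part_def count_list_conjugate card_image)
  }
qed

lemma finite_repeating_parts:
  assumes "0 < r"
  shows "finite {k. repeating_part r p k}"
proof (rule finite_subset)
  show "{k. repeating_part r p k} \<subseteq> set p"
    using assms by (metis (lifting) count_notin mem_Collect_eq not_less repeating_part_def subsetI)
qed simp

text \<open>By \<open>parts_above_Suc\<close>, a value \<open>Suc m\<close> is absent exactly when
  columns \<open>m\<close> and \<open>Suc m\<close> have equal length. Hence \<open>s\<close>
  consecutive absent values amount to \<open>s + 1\<close> equal columns, which is why
  \<open>r - 1\<close> is paired with \<open>r\<close>.\<close>

lemma missing_run_iff:
  "(\<forall>i<s. Suc a + i \<notin> set p) \<longleftrightarrow> (\<forall>i<Suc s. parts_above p (a + i) = parts_above p a)"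
proof (induction s)
  case (Suc s)
  have "Suc a + s \<notin> set p \<longleftrightarrow> parts_above p (a + Suc s) = parts_above p (a + s)"
    using parts_above_Suc[of "a + s" p] by (auto simp: count_list_0_iff)
  with Suc show ?case
    by (auto simp: All_less_Suc)
qed simp

text \<open>The chain mex marks the leftmost run of \<open>r\<close> equal columns. As column
  lengths do not increase, the height of this run is the greatest among all such runs, possibly
  0.\<close>

lemma chain_mex_conjugate:
  assumes "r \<ge> 2"
  shows "parts_above p (chain_mex (r - 1) p) = largest_repeating_part r (conjugate p)"
proof -
  define c where "c = chain_mex (r - 1) p"
  let ?missing = "\<lambda>k. 0 < k \<and> (\<forall>i<r - 1. k + i \<notin> set p)"
  \<comment> \<open>All values beyond the largest part are absent, so the \<open>LEAST\<close> in
    \<open>chain_mex\<close> is attained.\<close>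
  have "?missing (Suc (largest_part p))"
    using le_largest_part[of _ p] by fastforce
  then have c: "?missing c"
    unfolding c_def chain_mex_def by (rule LeastI)
  have c_le: "c \<le> k" if "?missing k" for k
    unfolding c_def chain_mex_def using that by (rule Least_le)
  have r: "Suc (r - 1) = r"
    using assms by simp
  obtain b where b: "c = Suc b"
    using c gr0_implies_Suc by blast
  have run: "\<forall>i<r. parts_above p (b + i) = parts_above p b"
    using c missing_run_iff[of "r - 1" b p] unfolding b r by blast
  \<comment> \<open>Since \<open>r\<close> is at least 2, the run starting at column
    \<open>b\<close> also contains column \<open>c = b + 1\<close>.\<close>
  then have above_c: "parts_above p c = parts_above p b"
    using assms unfolding b by (metis Suc_1 Suc_le_lessD add.commute plus_1_eq_Suc)
  let ?R = "insert 0 {k. repeating_part r (conjugate p) k}"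
  have "Max ?R = parts_above p c"
  proof (rule Max_eqI)
    show "finite ?R"
      using assms by (simp add: finite_repeating_parts)
    \<comment> \<open>A run of height 0 yields no repeating part; this case is covered by the
      inserted 0.\<close>
    show "parts_above p c \<in> ?R"
      using run above_c assms repeating_part_conjugate_iff[of "parts_above p c" r p]
      by (cases "parts_above p c = 0") auto
    fix k assume "k \<in> ?R"
    show "k \<le> parts_above p c"
    proof (cases "k = 0")
      case False
      with \<open>k \<in> ?R\<close> obtain a where a: "\<forall>i<r. parts_above p (a + i) = k"
        using assms repeating_part_conjugate_iff[of k r p] by auto
      moreover from a assms have a0: "parts_above p a = k"
        by (metis add_0_right not_numeral_le_zero zero_less_iff_neq_zero)
      \<comment> \<open>Any competing run competes in the definition of \<open>c\<close> as well, so
        it cannot start to the left of \<open>b\<close> and hence cannot be higher.\<close>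
      ultimately have "?missing (Suc a)"
        using missing_run_iff[of "r - 1" a p] unfolding r by simp
      then have "b \<le> a"
        using c_le unfolding b by blast
      then show ?thesis
        using parts_above_antimono a0 above_c by metis
    qed simp
  qed
  then show ?thesis
    by (simp add: largest_repeating_part_def c_def)
qed

section \<open>Splitting partitions\<close>

abbreviation positive_msets :: "nat multiset set" where
  "positive_msets \<equiv> {M. 0 \<notin># M}"

lemma bij_betw_mset_partitions:
  "bij_betw mset {p. is_partition n p} {M \<in> positive_msets. \<Sum>\<^sub># M = n}"
\<comment> \<open>The reversal is there because \<open>sorted_list_of_multiset\<close> is ascending
  and partitions are non-increasing.\<close>
proof (rule bij_betw_byWitness[where f' = "\<lambda>M. rev (sorted_list_of_multiset M)"])
  show "\<forall>p\<in>{p. is_partition n p}. rev (sorted_list_of_multiset (mset p)) = p"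
  proof
    fix p assume "p \<in> {p. is_partition n p}"
    then have "sorted (rev p)"
      by (simp add: is_partition_def sorted_wrt_rev)
    then have "sort p = rev p"
      by (intro properties_for_sort) simp_all
    then show "rev (sorted_list_of_multiset (mset p)) = p"
      by simp
  qed
  show "mset ` {p. is_partition n p} \<subseteq> {M \<in> positive_msets. \<Sum>\<^sub># M = n}"
    by (auto simp: is_partition_def sum_mset_sum_list)
  show "(\<lambda>M. rev (sorted_list_of_multiset M)) ` {M \<in> positive_msets. \<Sum>\<^sub># M = n}
      \<subseteq> {p. is_partition n p}"
    by (auto simp: is_partition_def sorted_wrt_rev simp flip: sum_mset_sum_list intro: gr0I)
qed simp

lemma card_partitions_eq_card_msets:
  "card {p. is_partition n p \<and> Q (mset p)} = card {M \<in> positive_msets. \<Sum>\<^sub># M = n \<and> Q M}"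
proof (rule bij_betw_same_card)
  have "bij_betw mset {p \<in> {p. is_partition n p}. Q (mset p)}
      {M \<in> {M \<in> positive_msets. \<Sum>\<^sub># M = n}. Q M}"
    by (rule bij_betw_Collect[OF bij_betw_mset_partitions]) simp
  then show "bij_betw mset {p. is_partition n p \<and> Q (mset p)}
      {M \<in> positive_msets. \<Sum>\<^sub># M = n \<and> Q M}"
    by (simp add: conj_assoc)
qed

lemma finite_partitions: "finite {p. is_partition n p}"
proof (rule finite_subset)
  show "{p. is_partition n p} \<subseteq> {p. set p \<subseteq> {..n} \<and> length p \<le> n}"
  proof clarify
    fix p assume p: "is_partition n p"
    then have "(\<Sum>x\<leftarrow>p. 1) \<le> (\<Sum>x\<leftarrow>p. x)"
      by (intro sum_list_mono) (auto simp: is_partition_def Suc_le_eq)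
    then show "set p \<subseteq> {..n} \<and> length p \<le> n"
      using p by (auto simp: is_partition_def sum_list_triv dest: member_le_sum_list)
  qed
  show "finite {p. set p \<subseteq> {..n} \<and> length p \<le> n}"
    by (rule finite_lists_length_le) simp
qed

lemma finite_positive_msets: "finite {M \<in> positive_msets. \<Sum>\<^sub># M = n \<and> Q M}"
proof (rule finite_subset)
  show "finite {M \<in> positive_msets. \<Sum>\<^sub># M = n}"
    using bij_betw_finite[OF bij_betw_mset_partitions] finite_partitions by blast
qed auto

text \<open>Common counting scheme for both splittings: grouping by the sum \<open>k\<close> of the
  second component gives a convolution, and the counted property \<open>Q\<close> is visible in that
  component alone.\<close>

lemma card_split:
  fixes f :: "nat multiset \<times> nat multiset \<Rightarrow> nat multiset"
  assumes f: "bij_betw f (C \<times> positive_msets) positive_msets"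
    and C: "C \<subseteq> positive_msets"
    and sum_f: "\<And>L N. L \<in> C \<Longrightarrow> 0 \<notin># N \<Longrightarrow> \<Sum>\<^sub># (f (L, N)) = \<Sum>\<^sub># L + r * \<Sum>\<^sub># N"
    and Q: "\<And>L N. L \<in> C \<Longrightarrow> 0 \<notin># N \<Longrightarrow> Q (f (L, N)) \<longleftrightarrow> Q' N"
    and r: "0 < r"
  shows "card {M \<in> positive_msets. \<Sum>\<^sub># M = n \<and> Q M} =
    (\<Sum>k | r * k \<le> n. card {L \<in> C. \<Sum>\<^sub># L = n - r * k} *
      card {N \<in> positive_msets. \<Sum>\<^sub># N = k \<and> Q' N})"
proof -
  let ?A = "\<lambda>k. {L \<in> C. \<Sum>\<^sub># L = n - r * k}"
  let ?B = "\<lambda>k. {N \<in> positive_msets. \<Sum>\<^sub># N = k \<and> Q' N}"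
  let ?K = "{k. r * k \<le> n}"
  let ?S = "\<Union>k\<in>?K. ?A k \<times> ?B k"
  have "k \<le> n" if "r * k \<le> n" for k
    using that r by (metis One_nat_def Suc_leI le_trans mult_le_mono1 nat_mult_1)
  then have "finite ?K"
    by (auto intro: finite_subset[of _ "{..n}"])
  \<comment> \<open>The condition \<open>r * k \<le> n\<close> keeps the subtraction
    \<open>n - r * k\<close> from being truncated, so it can be rewritten as a sum.\<close>
  have S: "?S = {(L, N). L \<in> C \<and> 0 \<notin># N \<and> \<Sum>\<^sub># L + r * \<Sum>\<^sub># N = n \<and> Q' N}"
    by auto
  have "f ` ?S = {M \<in> positive_msets. \<Sum>\<^sub># M = n \<and> Q M}"
  proof
    show "f ` ?S \<subseteq> {M \<in> positive_msets. \<Sum>\<^sub># M = n \<and> Q M}"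
      unfolding S using bij_betwE[OF f] by (auto simp: sum_f Q)
    show "{M \<in> positive_msets. \<Sum>\<^sub># M = n \<and> Q M} \<subseteq> f ` ?S"
    proof
      fix M assume M: "M \<in> {M \<in> positive_msets. \<Sum>\<^sub># M = n \<and> Q M}"
      then have "M \<in> f ` (C \<times> positive_msets)"
        using bij_betw_imp_surj_on[OF f] by simp
      then obtain L N where "M = f (L, N)" "L \<in> C" "0 \<notin># N"
        by auto
      with M show "M \<in> f ` ?S"
        unfolding S by (auto simp: sum_f Q)
    qed
  qed
  moreover have "inj_on f ?S"
    unfolding S by (rule inj_on_subset[OF bij_betw_imp_inj_on[OF f]]) auto
  ultimately have "card {M \<in> positive_msets. \<Sum>\<^sub># M = n \<and> Q M} = card ?S"
    using card_image[of f ?S] by simp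
  also have "\<dots> = (\<Sum>k\<in>?K. card (?A k \<times> ?B k))"
  \<comment> \<open>The blocks are disjoint because \<open>k\<close> is recovered as the sum of the
    second component.\<close>
  proof (rule card_UN_disjoint[OF \<open>finite ?K\<close>])
    have "finite (?A k)" for k
      by (rule finite_subset[OF _ finite_positive_msets[of "n - r * k" "\<lambda>_. True"]]) (use C in auto)
    then show "\<forall>k\<in>?K. finite (?A k \<times> ?B k)"
      by (intro ballI finite_cartesian_product finite_positive_msets)
  qed auto
  finally show ?thesis
    by (simp add: card_cartesian_product)
qed

section \<open>The two splittings and their convolutions\<close>

definition regular_msets :: "nat \<Rightarrow> nat multiset set" where
  "regular_msets r = {M \<in> positive_msets. \<forall>x\<in>#M. \<not> r dvd x}"

definition nonrepeating_msets :: "nat \<Rightarrow> nat multiset set" where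
  "nonrepeating_msets r = {M \<in> positive_msets. \<forall>x. count M x < r}"

lemma bij_betw_split_multiples:
  assumes "0 < r"
  shows "bij_betw (\<lambda>(L, N). L + image_mset ((*) r) N) (regular_msets r \<times> positive_msets)
    positive_msets"
proof (rule bij_betw_byWitness[where
      f' = "\<lambda>M. (filter_mset (\<lambda>x. \<not> r dvd x) M, image_mset (\<lambda>x. x div r) (filter_mset (\<lambda>x. r dvd x) M))"])
  have 1: "filter_mset (\<lambda>x. \<not> r dvd x) L = L" "filter_mset (\<lambda>x. r dvd x) L = {#}"
    if "L \<in> regular_msets r" for L
    using that by (auto simp: regular_msets_def filter_mset_eq_conv)
  have 2: "filter_mset (\<lambda>x. \<not> r dvd x) (image_mset ((*) r) N) = {#}"
    "filter_mset (\<lambda>x. r dvd x) (image_mset ((*) r) N) = image_mset ((*) r) N" for N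
    by (simp_all add: filter_mset_image_mset)
  show "\<forall>M\<in>regular_msets r \<times> positive_msets.
      (filter_mset (\<lambda>x. \<not> r dvd x) (case M of (L, N) \<Rightarrow> L + image_mset ((*) r) N),
       image_mset (\<lambda>x. x div r)
         (filter_mset (\<lambda>x. r dvd x) (case M of (L, N) \<Rightarrow> L + image_mset ((*) r) N))) = M"
    using assms by (auto simp: 1 2 multiset.map_comp o_def)
  \<comment> \<open>Multiplication by \<open>r\<close> undoes \<open>div r\<close> only on multiples
    of \<open>r\<close>, so the congruence must use the filter.\<close>
  have 3: "image_mset ((*) r) (image_mset (\<lambda>x. x div r) (filter_mset (\<lambda>x. r dvd x) M)) =
      filter_mset (\<lambda>x. r dvd x) M" for M
  proof -
    have "image_mset (\<lambda>x. r * (x div r)) (filter_mset (\<lambda>x. r dvd x) M) =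
        image_mset (\<lambda>x. x) (filter_mset (\<lambda>x. r dvd x) M)"
      by (rule image_mset_cong) simp
    then show ?thesis by (simp add: multiset.map_comp o_def)
  qed
  show "\<forall>M\<in>positive_msets.
      (case (filter_mset (\<lambda>x. \<not> r dvd x) M,
          image_mset (\<lambda>x. x div r) (filter_mset (\<lambda>x. r dvd x) M)) of
        (L, N) \<Rightarrow> L + image_mset ((*) r) N) = M"
    by (simp add: 3 add.commute flip: multiset_partition)
  show "(\<lambda>(L, N). L + image_mset ((*) r) N) ` (regular_msets r \<times> positive_msets) \<subseteq> positive_msets"
    using assms by (auto simp: regular_msets_def)
  show "(\<lambda>M. (filter_mset (\<lambda>x. \<not> r dvd x) M,
        image_mset (\<lambda>x. x div r) (filter_mset (\<lambda>x. r dvd x) M))) ` positive_msets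
      \<subseteq> regular_msets r \<times> positive_msets"
    using assms by (auto simp: regular_msets_def dvd_div_eq_0_iff)
qed

text \<open>Division with remainder applied to each multiplicity: \<open>L\<close> carries the
  remainders and \<open>N\<close> the quotients.\<close>

lemma bij_betw_split_multiplicities:
  assumes "0 < r"
  shows "bij_betw (\<lambda>(L, N). L + repeat_mset r N) (nonrepeating_msets r \<times> positive_msets)
    positive_msets"
proof (rule bij_betw_imageI)
  show "inj_on (\<lambda>(L, N). L + repeat_mset r N) (nonrepeating_msets r \<times> positive_msets)"
  proof (rule inj_onI, clarify)
    fix L N L' N'
    assume L: "L \<in> nonrepeating_msets r" "L' \<in> nonrepeating_msets r"
      and eq: "L + repeat_mset r N = L' + repeat_mset r N'"
    have *: "count L x + r * count N x = count L' x + r * count N' x" for x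
      using arg_cong[OF eq, of "\<lambda>M. count M x"] by simp
    have lt: "count L x < r" "count L' x < r" for x
      using L by (auto simp: nonrepeating_msets_def)
    have "count L x = count L' x" for x
      using arg_cong[OF *[of x], of "\<lambda>m. m mod r"] lt[of x] by simp
    then have "L = L'"
      by (rule multiset_eqI)
    moreover from this have "N = N'"
      using * assms by (intro multiset_eqI) auto
    ultimately show "L = L' \<and> N = N'" ..
  qed
  show "(\<lambda>(L, N). L + repeat_mset r N) ` (nonrepeating_msets r \<times> positive_msets) = positive_msets"
  proof
    show "(\<lambda>(L, N). L + repeat_mset r N) ` (nonrepeating_msets r \<times> positive_msets)
        \<subseteq> positive_msets"
      by (auto simp: nonrepeating_msets_def not_in_iff)
    show "positive_msets \<subseteq>
        (\<lambda>(L, N). L + repeat_mset r N) ` (nonrepeating_msets r \<times> positive_msets)"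
    proof
      fix M :: "nat multiset" assume M: "M \<in> positive_msets"
      \<comment> \<open>Remainders and quotients vanish wherever \<open>count M\<close> does, so
        both functions have finite support and define multisets.\<close>
      define L where "L = Abs_multiset (\<lambda>x. count M x mod r)"
      define N where "N = Abs_multiset (\<lambda>x. count M x div r)"
      have fin: "finite {x. 0 < count M x}"
        by simp
      have L: "count L x = count M x mod r" for x
        unfolding L_def
        by (subst count_Abs_multiset) (auto intro!: finite_subset[OF _ fin] intro: gr0I)
      have N: "count N x = count M x div r" for x
        unfolding N_def
        by (subst count_Abs_multiset) (auto intro!: finite_subset[OF _ fin] intro: gr0I)
      have "M = L + repeat_mset r N"
        by (rule multiset_eqI) (simp add: L N)
      moreover have "L \<in> nonrepeating_msets r" "N \<in> positive_msets"
        using M assms by (auto simp: nonrepeating_msets_def not_in_iff L N)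
      ultimately show "M \<in> (\<lambda>(L, N). L + repeat_mset r N) `
          (nonrepeating_msets r \<times> positive_msets)"
        by auto
    qed
  qed
qed

lemma sum_mset_repeat_mset: "\<Sum>\<^sub># (repeat_mset r N) = r * \<Sum>\<^sub># N"
  for N :: "nat multiset"
  by (induction r) simp_all

lemma sum_mset_image_mult: "\<Sum>\<^sub># (image_mset ((*) r) N) = r * \<Sum>\<^sub># N"
  for N :: "nat multiset"
  by (induction N) (simp_all add: distrib_left)

lemma card_split_multiples:
  assumes "0 < r"
    and "\<And>L N. L \<in> regular_msets r \<Longrightarrow> 0 \<notin># N \<Longrightarrow> Q (L + image_mset ((*) r) N) \<longleftrightarrow> Q' N"
  shows "card {M \<in> positive_msets. \<Sum>\<^sub># M = n \<and> Q M} =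
    (\<Sum>k | r * k \<le> n. card {L \<in> regular_msets r. \<Sum>\<^sub># L = n - r * k} *
      card {N \<in> positive_msets. \<Sum>\<^sub># N = k \<and> Q' N})"
  by (rule card_split[OF bij_betw_split_multiples])
    (use assms in \<open>auto simp: regular_msets_def sum_mset_image_mult\<close>)

lemma card_split_multiplicities:
  assumes "0 < r"
    and "\<And>L N. L \<in> nonrepeating_msets r \<Longrightarrow> 0 \<notin># N \<Longrightarrow> Q (L + repeat_mset r N) \<longleftrightarrow> Q' N"
  shows "card {M \<in> positive_msets. \<Sum>\<^sub># M = n \<and> Q M} =
    (\<Sum>k | r * k \<le> n. card {L \<in> nonrepeating_msets r. \<Sum>\<^sub># L = n - r * k} *
      card {N \<in> positive_msets. \<Sum>\<^sub># N = k \<and> Q' N})"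
  by (rule card_split[OF bij_betw_split_multiplicities])
    (use assms in \<open>auto simp: nonrepeating_msets_def sum_mset_repeat_mset\<close>)

text \<open>Both counts have the same convolution with the partition numbers. The partition number
  of 0 is 1, so the term \<open>k = 0\<close> determines the count at \<open>n\<close> from those at
  smaller arguments.\<close>

theorem glaisher:
  assumes "0 < r"
  shows "card {L \<in> regular_msets r. \<Sum>\<^sub># L = n} = card {L \<in> nonrepeating_msets r. \<Sum>\<^sub># L = n}"
proof (induction n rule: less_induct)
  case (less n)
  let ?R = "\<lambda>n. card {L \<in> regular_msets r. \<Sum>\<^sub># L = n}"
  let ?D = "\<lambda>n. card {L \<in> nonrepeating_msets r. \<Sum>\<^sub># L = n}"
  \<comment> \<open>The conjunct \<open>True\<close> matches the shape of the splitting formulas for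
    trivial \<open>Q\<close> and \<open>Q'\<close>.\<close>
  let ?P = "\<lambda>k. card {N \<in> positive_msets. \<Sum>\<^sub># N = k \<and> True}"
  let ?K = "{k. r * k \<le> n}"
  have "k \<le> n" if "r * k \<le> n" for k
    using that assms by (metis One_nat_def Suc_leI le_trans mult_le_mono1 nat_mult_1)
  then have fin: "finite ?K"
    by (auto intro: finite_subset[of _ "{..n}"])
  have zero: "0 \<in> ?K"
    by simp
  have "{N \<in> positive_msets. \<Sum>\<^sub># N = 0 \<and> True} = {{#}}"
    by (auto simp: sum_mset_0_iff) (metis multiset_nonemptyE)
  then have P0: "?P 0 = 1"
    by simp
  have "(\<Sum>k\<in>?K. ?R (n - r * k) * ?P k) = (\<Sum>k\<in>?K. ?D (n - r * k) * ?P k)"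
    using card_split_multiples[of r "\<lambda>_. True" "\<lambda>_. True" n]
      card_split_multiplicities[of r "\<lambda>_. True" "\<lambda>_. True" n] assms by simp
  \<comment> \<open>For positive \<open>k\<close> the argument \<open>n - r * k\<close> is smaller
    than \<open>n\<close>, so the induction hypothesis makes these terms agree and only
    \<open>k = 0\<close> is left.\<close>
  moreover have "(\<Sum>k\<in>?K - {0}. ?R (n - r * k) * ?P k) = (\<Sum>k\<in>?K - {0}. ?D (n - r * k) * ?P k)"
  proof (rule sum.cong[OF refl])
    fix k assume "k \<in> ?K - {0}"
    then have "n - r * k < n"
      using assms by (auto intro!: diff_less gr0I)
    then show "?R (n - r * k) * ?P k = ?D (n - r * k) * ?P k"
      using less by simp
  qed
  ultimately have "?R (n - r * 0) * ?P 0 = ?D (n - r * 0) * ?P 0"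
    unfolding sum.remove[OF fin zero] by simp
  then show ?case
    unfolding P0 by simp
qed

text \<open>Conjugation exchanges the number of parts and the largest part; the detour through lists
  is needed because \<open>conjugate\<close> acts on lists.\<close>

lemma card_size_eq_card_Max:
  "card {N \<in> positive_msets. \<Sum>\<^sub># N = k \<and> size N = j} =
   card {N \<in> positive_msets. \<Sum>\<^sub># N = k \<and> Max (insert 0 (set_mset N)) = j}"
proof -
  have "card {p. is_partition k p \<and> size (mset p) = j} =
      card {p. is_partition k p \<and> Max (insert 0 (set_mset (mset p))) = j}"
    using largest_part_conjugate
    by (intro card_conjugate) (simp add: largest_part_def)
  then show ?thesis
    unfolding card_partitions_eq_card_msets[where Q = "\<lambda>M. size M = j"]
      card_partitions_eq_card_msets[where Q = "\<lambda>M. Max (insert 0 (set_mset M)) = j"] .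
qed

section \<open>Comparison of the two convolutions and the final equalities\<close>

lemma card_multiples_eq_card_largest_repeating:
  assumes "0 < r"
  shows "card {p. is_partition n p \<and> length (filter (\<lambda>x. r dvd x) p) = j} =
    card {p. is_partition n p \<and> largest_repeating_part r p = j}"
proof -
  have "card {p. is_partition n p \<and> length (filter (\<lambda>x. r dvd x) p) = j} =
      card {p. is_partition n p \<and> size (filter_mset (\<lambda>x. r dvd x) (mset p)) = j}"
    by (simp flip: mset_filter)
  also have "\<dots> = card {M \<in> positive_msets. \<Sum>\<^sub># M = n \<and> size (filter_mset (\<lambda>x. r dvd x) M) = j}"
    by (rule card_partitions_eq_card_msets)
  also have "\<dots> = (\<Sum>k | r * k \<le> n. card {L \<in> regular_msets r. \<Sum>\<^sub># L = n - r * k} *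
      card {N \<in> positive_msets. \<Sum>\<^sub># N = k \<and> size N = j})"
  proof (rule card_split_multiples[OF assms])
    fix L N assume "L \<in> regular_msets r"
    then have L: "filter_mset (\<lambda>x. r dvd x) L = {#}"
      by (simp add: regular_msets_def)
    show "size (filter_mset (\<lambda>x. r dvd x) (L + image_mset ((*) r) N)) = j \<longleftrightarrow> size N = j"
      by (simp add: filter_mset_image_mset L)
  qed
  \<comment> \<open>Term by term, Glaisher's theorem replaces the first factor and conjugation the
    second.\<close>
  also have "\<dots> = (\<Sum>k | r * k \<le> n. card {L \<in> nonrepeating_msets r. \<Sum>\<^sub># L = n - r * k} *
      card {N \<in> positive_msets. \<Sum>\<^sub># N = k \<and> Max (insert 0 (set_mset N)) = j})"
    by (simp only: glaisher[OF assms] card_size_eq_card_Max)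
  also have "\<dots> = card {M \<in> positive_msets. \<Sum>\<^sub># M = n \<and> Max (insert 0 {k. r \<le> count M k}) = j}"
  proof (rule card_split_multiplicities[OF assms, symmetric])
    fix L N assume "L \<in> nonrepeating_msets r"
    then have L: "count L k < r" for k
      by (simp add: nonrepeating_msets_def)
    \<comment> \<open>Each part of \<open>N\<close> contributes at least \<open>r\<close> copies,
      whereas \<open>L\<close> alone never reaches \<open>r\<close>.\<close>
    have "r \<le> count (L + repeat_mset r N) k \<longleftrightarrow> k \<in># N" for k
    proof (cases "k \<in># N")
      case True
      then have "r * 1 \<le> r * count N k"
        by (intro mult_le_mono2) (simp add: Suc_le_eq)
      then have "r \<le> count (L + repeat_mset r N) k"
        by (simp only: count_union count_repeat_mset mult_1_right trans_le_add2)
      with True show ?thesis by blast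
    next
      case False
      with L[of k] show ?thesis by (simp add: not_in_iff)
    qed
    then show "Max (insert 0 {k. r \<le> count (L + repeat_mset r N) k}) = j \<longleftrightarrow>
        Max (insert 0 (set_mset N)) = j"
      by simp
  qed
  also have "\<dots> = card {p. is_partition n p \<and> Max (insert 0 {k. r \<le> count (mset p) k}) = j}"
    by (rule card_partitions_eq_card_msets[symmetric])
  also have "\<dots> = card {p. is_partition n p \<and> largest_repeating_part r p = j}"
    by (simp add: largest_repeating_part_def repeating_part_def count_mset)
  finally show ?thesis .
qed

theorem theorem2p5:
  fixes j n r :: nat
  assumes "r \<ge> 2"
  shows "card {p. is_partition n p \<and> length (filter (\<lambda>x. r dvd x) p) = j} =
           card {p. is_partition n p \<and> largest_repeating_part r p = j} \<and>
         card {p. is_partition n p \<and> largest_repeating_part r p = j} =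
           card {p. is_partition n p \<and> length (filter (\<lambda>x. chain_mex (r - 1) p < x) p) = j}"
proof
  show "card {p. is_partition n p \<and> length (filter (\<lambda>x. r dvd x) p) = j} =
      card {p. is_partition n p \<and> largest_repeating_part r p = j}"
    using assms by (intro card_multiples_eq_card_largest_repeating) simp
  show "card {p. is_partition n p \<and> largest_repeating_part r p = j} =
      card {p. is_partition n p \<and> length (filter (\<lambda>x. chain_mex (r - 1) p < x) p) = j}"
    \<comment> \<open>The chain mex statistic of \<open>p\<close> is the repeating part statistic of
      its conjugate, so the chain mex side is the source and the equation is read backwards.\<close>
    by (rule card_conjugate[symmetric]) (simp only: chain_mex_conjugate[OF assms])
qed

end
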